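(* Let $\Lambda$ be a numerical semigroup of embedding dimension $n\ge 2$ and let $I$ be an irreducible ideal of $\Lambda$. Then the graph $G_I(\Lambda)$ is non-planar if one of the following holds: (1) $|G_I(\Lambda)|\ge 8$; (2) $|G_I(\Lambda)|=6$ and $G_I(\Lambda)$ is isomorphic to one of the graphs $H_5,H_6$; (3) $|G_I(\Lambda)|=7$ and $G_I(\Lambda)$ is isomorphic to one of the graphs $K_4,K_5,K_6$. Here $H_5,H_6$ and $K_4,K_5,K_6$ are the explicit graphs listed in the context (not to be confused with complete graphs).
   Context: A numerical semigroup is a submonoid $\Lambda$ of $(\mathbb{Z}_{\ge 0},+)$ with finite complement; its embedding dimension is the cardinality of its minimal system of generators. An ideal of $\Lambda$ is a nonempty subset $I\subset\Lambda$ with $I+\Lambda\subset I$. It is irreducible if it is a proper ideal that cannot be written as an intersection of two or more proper ideals each properly containing it. (Known fact, due to Barucci: every irreducible ideal of $\Lambda$ has the form $\Lambda\setminus B(x)$ for some $x\in\Lambda$, where $B(x)=\{y\in\Lambda: x-y\in\Lambda\}$.) The graph $G_I(\Lambda)$ is the simple graph with vertex set $\{v_i : i\in(\Lambda\setminus I)\setminus\{0\}\}$ in which distinct vertices $v_i,v_j$ are adjacent if and only if $i+j\in I$. $|G|$ denotes the order (number of vertices) of $G$. Graphs of order 6, on vertex set $\{1,\dots,6\}$ ($ij$ denotes the edge $\{i,j\}$): $H_5$: $12,14,15,23,24,25,26,34,35,36,46,56$. $H_6$: $12,14,15,16,23,24,25,26,34,35,36,46,56$. Graphs of order 7, on vertex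 set $\{1,\dots,7\}$: in each of $K_4,K_5,K_6$ the vertex $3$ is adjacent to all other vertices, and the remaining edges are: $K_4$: $14,15,16,17,24,25,26,27,57,67$. $K_5$: $12,15,16,17,26,27,45,46,47,56,57$. $K_6$: $14,15,16,17,24,25,26,27,46,47,56,57$. *)

theory Defs
  imports "HOL-Analysis.Analysis"
begin

section \<open>Numerical semigroups and their ideals\<close>

definition numerical_semigroup :: "nat set \<Rightarrow> bool" where
  "numerical_semigroup L \<longleftrightarrow>
     0 \<in> L \<and> (\<forall>x\<in>L. \<forall>y\<in>L. x + y \<in> L) \<and> finite (UNIV - L)"

inductive_set submonoid_generated :: "nat set \<Rightarrow> nat set" for A where
  zero: "0 \<in> submonoid_generated A"
| gen: "a \<in> A \<Longrightarrow> a \<in> submonoid_generated A"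
| add: "x \<in> submonoid_generated A \<Longrightarrow> y \<in> submonoid_generated A
          \<Longrightarrow> x + y \<in> submonoid_generated A"

definition minimal_generating_system :: "nat set \<Rightarrow> nat set \<Rightarrow> bool" where
  "minimal_generating_system L A \<longleftrightarrow>
     submonoid_generated A = L \<and> (\<forall>B. B \<subset> A \<longrightarrow> submonoid_generated B \<noteq> L)"

lemma minimal_generating_system_unique:
  assumes "numerical_semigroup L"
  shows "\<exists>!A. minimal_generating_system L A"
proof -
  have z: "0 \<in> L" and pl: "\<And>x y. x \<in> L \<Longrightarrow> y \<in> L \<Longrightarrow> x + y \<in> L"
    using assms by (auto simp: numerical_semigroup_def)
  define M where "M = {a \<in> L. a \<noteq> 0 \<and> (\<forall>b\<in>L. \<forall>c\<in>L. a = b + c \<longrightarrow> b = 0 \<or> c = 0)}"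
  have least: "M \<subseteq> A" if gen: "submonoid_generated A = L" for A
  proof
    fix x assume x: "x \<in> M"
    have "y \<in> submonoid_generated A \<Longrightarrow> y = 0 \<or> y \<in> A \<or>
        (\<exists>b\<in>L. \<exists>c\<in>L. b \<noteq> 0 \<and> c \<noteq> 0 \<and> y = b + c)" for y
    proof (induction rule: submonoid_generated.induct)
      case (add x y)
      then show ?case using gen by (cases "x = 0"; cases "y = 0") auto
    qed auto
    from this[of x] x gen show "x \<in> A" unfolding M_def by auto
  qed
  have "x \<in> L" if "x \<in> submonoid_generated M" for x
    using that by induction (auto simp: z pl M_def)
  moreover have "x \<in> L \<Longrightarrow> x \<in> submonoid_generated M" for x
  proof (induction x rule: less_induct)
    case (less x)
    show ?case
    proof (cases "x = 0 \<or> x \<in> M")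
      case True
      then show ?thesis by (auto intro: submonoid_generated.intros)
    next
      case False
      then obtain b c where bc: "b \<in> L" "c \<in> L" "x = b + c" "b \<noteq> 0" "c \<noteq> 0"
        using less.prems unfolding M_def by auto
      then show ?thesis using less.IH[of b] less.IH[of c]
        by (auto intro: submonoid_generated.add)
    qed
  qed
  ultimately have M: "submonoid_generated M = L" by blast
  show ?thesis
  proof (rule ex1I[of _ M])
    show "minimal_generating_system L M"
      unfolding minimal_generating_system_def using M least by blast
    show "A = M" if "minimal_generating_system L A" for A
      using that M least unfolding minimal_generating_system_def by blast
  qed
qed

definition embedding_dimension :: "nat set \<Rightarrow> nat" where
  "embedding_dimension L = card (THE A. minimal_generating_system L A)"

definition semigroup_ideal :: "nat set \<Rightarrow> nat set \<Rightarrow> bool" where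
  "semigroup_ideal L I \<longleftrightarrow> I \<noteq> {} \<and> I \<subseteq> L \<and> (\<forall>i\<in>I. \<forall>s\<in>L. i + s \<in> I)"

definition proper_ideal :: "nat set \<Rightarrow> nat set \<Rightarrow> bool" where
  "proper_ideal L I \<longleftrightarrow> semigroup_ideal L I \<and> I \<noteq> L"

text \<open>Since \<open>card\<close> is 0 on infinite sets, the families \<open>F\<close> below are finite. This is no
  restriction for a numerical semigroup, where only finitely many ideals contain a given one.\<close>

definition irreducible_ideal :: "nat set \<Rightarrow> nat set \<Rightarrow> bool" where
  "irreducible_ideal L I \<longleftrightarrow> proper_ideal L I \<and>
     \<not> (\<exists>F. card F \<ge> 2 \<and> (\<forall>J\<in>F. proper_ideal L J \<and> I \<subset> J) \<and> I = \<Inter>F)"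

section \<open>Simple graphs\<close>

text \<open>Edges are two-element sets of vertices.\<close>

record 'a simple_graph =
  verts :: "'a set"
  edges :: "'a set set"

definition graph_order :: "'a simple_graph \<Rightarrow> nat" where
  "graph_order G = card (verts G)"

definition graph_isomorphic :: "'a simple_graph \<Rightarrow> 'b simple_graph \<Rightarrow> bool" where
  "graph_isomorphic G H \<longleftrightarrow> (\<exists>f. bij_betw f (verts G) (verts H) \<and>
     (\<forall>u\<in>verts G. \<forall>v\<in>verts G. {u, v} \<in> edges G \<longleftrightarrow> {f u, f v} \<in> edges H))"

text \<open>A drawing in the plane, taken to be the type \<open>complex\<close>: \<open>p\<close> places the vertices at distinct
  points, \<open>\<gamma>\<close> assigns to each edge an arc (an injective path) joining the places of its two ends
  and passing through no other vertex, and two different edges meet at most in a common end.\<close>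

definition plane_drawing ::
    "'a simple_graph \<Rightarrow> ('a \<Rightarrow> complex) \<Rightarrow> ('a set \<Rightarrow> real \<Rightarrow> complex) \<Rightarrow> bool" where
  "plane_drawing G p \<gamma> \<longleftrightarrow>
     inj_on p (verts G) \<and>
     (\<forall>e\<in>edges G. arc (\<gamma> e) \<and> {pathstart (\<gamma> e), pathfinish (\<gamma> e)} = p ` e \<and>
        path_image (\<gamma> e) \<inter> p ` verts G = p ` e) \<and>
     (\<forall>e\<in>edges G. \<forall>e'\<in>edges G. e \<noteq> e' \<longrightarrow>
        path_image (\<gamma> e) \<inter> path_image (\<gamma> e') \<subseteq> p ` (e \<inter> e'))"

definition planar :: "'a simple_graph \<Rightarrow> bool" where
  "planar G \<longleftrightarrow> (\<exists>p \<gamma>. plane_drawing G p \<gamma>)"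

text \<open>The vertex \<open>v\<^sub>i\<close> is represented by \<open>i\<close> itself.\<close>

definition ideal_graph :: "nat set \<Rightarrow> nat set \<Rightarrow> nat simple_graph" where
  "ideal_graph L I =
     \<lparr>verts = (L - I) - {0},
      edges = {{i, j} |i j. i \<in> (L - I) - {0} \<and> j \<in> (L - I) - {0} \<and> i \<noteq> j \<and> i + j \<in> I}\<rparr>"

definition H\<^sub>5 :: "nat simple_graph" where
  "H\<^sub>5 = \<lparr>verts = {1..6},
    edges = {{1,2}, {1,4}, {1,5}, {2,3}, {2,4}, {2,5}, {2,6}, {3,4}, {3,5}, {3,6}, {4,6}, {5,6}}\<rparr>"

definition H\<^sub>6 :: "nat simple_graph" where
  "H\<^sub>6 = \<lparr>verts = {1..6},
    edges = {{1,2}, {1,4}, {1,5}, {1,6}, {2,3}, {2,4}, {2,5}, {2,6}, {3,4}, {3,5}, {3,6},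
             {4,6}, {5,6}}\<rparr>"

text \<open>The following three graphs are not complete graphs; in each of them the vertex 3 is adjacent
  to all the others.\<close>

definition K\<^sub>4 :: "nat simple_graph" where
  "K\<^sub>4 = \<lparr>verts = {1..7},
    edges = {{3,1}, {3,2}, {3,4}, {3,5}, {3,6}, {3,7}} \<union>
            {{1,4}, {1,5}, {1,6}, {1,7}, {2,4}, {2,5}, {2,6}, {2,7}, {5,7}, {6,7}}\<rparr>"

definition K\<^sub>5 :: "nat simple_graph" where
  "K\<^sub>5 = \<lparr>verts = {1..7},
    edges = {{3,1}, {3,2}, {3,4}, {3,5}, {3,6}, {3,7}} \<union>
            {{1,2}, {1,5}, {1,6}, {1,7}, {2,6}, {2,7}, {4,5}, {4,6}, {4,7}, {5,6}, {5,7}}\<rparr>"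

definition K\<^sub>6 :: "nat simple_graph" where
  "K\<^sub>6 = \<lparr>verts = {1..7},
    edges = {{3,1}, {3,2}, {3,4}, {3,5}, {3,6}, {3,7}} \<union>
            {{1,4}, {1,5}, {1,6}, {1,7}, {2,4}, {2,5}, {2,6}, {2,7}, {4,6}, {4,7}, {5,6}, {5,7}}\<rparr>"

end

theory Submission
  imports Defs
begin

text \<open>Barucci's theorem gives \<open>I = L - B(x)\<close>. Since \<open>B(x)\<close> is stable under \<open>w \<mapsto> x - w\<close>, the sum of
  two distinct elements among the five largest of \<open>B(x)\<close> leaves \<open>B(x)\<close> as soon as the graph has
  eight vertices, so these five span a complete graph; each of the graphs of order 6 and 7
  contains a complete bipartite graph on 3 + 3 vertices. Such graphs are not planar because of the
  Jordan curve theorem: two chords of a simple closed curve with interlaced ends cannot be drawn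
  disjointly on the same side. The three long chords of a hexagon are pairwise interlaced, and
  the five chords of a pentagon form an odd cycle of interlaced pairs, whereas there are only two
  sides.\<close>

section \<open>Chords of a simple closed curve\<close>

text \<open>Arcs are point sets with two named ends: \<open>inside\<close> and
  \<open>outside\<close> depend on the set alone, and edges of a drawing carry no direction.\<close>

definition arc_between :: "complex set \<Rightarrow> complex \<Rightarrow> complex \<Rightarrow> bool" where
  "arc_between S a b \<longleftrightarrow> (\<exists>g. arc g \<and> pathstart g = a \<and> pathfinish g = b \<and> path_image g = S)"

lemma arc_between_sym: "arc_between S a b \<Longrightarrow> arc_between S b a"
  unfolding arc_between_def
  by (metis arc_reversepath path_image_reversepath pathfinish_reversepath pathstart_reversepath)

lemma arc_between_ends: "arc_between S a b \<Longrightarrow> a \<in> S \<and> b \<in> S \<and> a \<noteq> b"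
  unfolding arc_between_def
  using arc_distinct_ends pathfinish_in_path_image pathstart_in_path_image by blast

lemma arc_between_Un:
  assumes "arc_between S a b" "arc_between T b c" "S \<inter> T = {b}"
  shows "arc_between (S \<union> T) a c"
proof -
  obtain g h where "arc g" "pathstart g = a" "pathfinish g = b" "path_image g = S"
    "arc h" "pathstart h = b" "pathfinish h = c" "path_image h = T"
    using assms(1,2) unfolding arc_between_def by blast
  then show ?thesis
    unfolding arc_between_def using assms(3)
    by (intro exI[of _ "g +++ h"]) (auto simp: arc_join path_image_join)
qed

lemma arc_between_interior:
  assumes "arc_between S a b"
  shows "connected (S - {a, b})" and "S - {a, b} \<noteq> {}" and "S \<subseteq> closure (S - {a, b})"
proof -
  obtain g where g: "arc g" "pathstart g = a" "pathfinish g = b" "path_image g = S"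
    using assms unfolding arc_between_def by blast
  then have sp: "simple_path g" by (simp add: arc_imp_simple_path)
  have eq: "S - {a, b} = g ` {0<..<1}"
    using simple_path_endless[OF sp] g by simp
  show "connected (S - {a, b})" using connected_simple_path_endless[OF sp] g by simp
  show "S - {a, b} \<noteq> {}" unfolding eq by simp
  \<comment> \<open>The unit interval is the closure of its interior, and a continuous map sends a
    closure into the closure of the image.\<close>
  have "continuous_on (closure {0<..<1}) g"
    using g(1) by (simp add: arc_def path_def)
  then have "g ` closure {0<..<1} \<subseteq> closure (g ` {0<..<1})"
    by (rule image_closure_subset) (auto simp: closure_subset)
  then show "S \<subseteq> closure (S - {a, b})"
    unfolding eq using g(4) by (simp add: path_image_def)
qed

lemma arc_between_image:
  assumes "arc_between S a b" "continuous_on S f" "inj_on f S"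
  shows "arc_between (f ` S) (f a) (f b)"
proof -
  obtain g where g: "arc g" "pathstart g = a" "pathfinish g = b" "path_image g = S"
    using assms(1) unfolding arc_between_def by blast
  have "arc (f \<circ> g)"
    using g assms(2,3) unfolding arc_def path_image_def
    by (auto intro: path_continuous_image[unfolded path_image_def] comp_inj_on)
  then show ?thesis
    unfolding arc_between_def using g
    by (intro exI[of _ "f \<circ> g"]) (auto simp: pathstart_compose pathfinish_compose path_image_compose)
qed

definition simple_closed :: "complex set \<Rightarrow> bool" where
  "simple_closed J \<longleftrightarrow> (\<exists>g. simple_path g \<and> pathfinish g = pathstart g \<and> path_image g = J)"

lemma arc_between_simple_closed:
  assumes "arc_between A a b" "arc_between B a b" "A \<inter> B = {a, b}"
  shows "simple_closed (A \<union> B)"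
proof -
  obtain g where g: "arc g" "pathstart g = a" "pathfinish g = b" "path_image g = A"
    using assms(1) unfolding arc_between_def by blast
  obtain h where h: "arc h" "pathstart h = b" "pathfinish h = a" "path_image h = B"
    using arc_between_sym[OF assms(2)] unfolding arc_between_def by blast
  show ?thesis
    unfolding simple_closed_def using g h assms(3)
    by (intro exI[of _ "g +++ h"]) (auto simp: simple_path_join_loop path_image_join)
qed

text \<open>The open chord is connected and misses \<open>J\<close>; a connected set meeting both
  \<open>inside J\<close> and \<open>outside J\<close> would meet \<open>J\<close>.\<close>

lemma chord_inside_or_outside:
  assumes "arc_between P a b" "P \<inter> J = {a, b}"
  shows "P - {a, b} \<subseteq> inside J \<or> P - {a, b} \<subseteq> outside J"
proof -
  have "P - {a, b} \<subseteq> - J" using assms(2) by auto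
  moreover from this have "inside J \<inter> (P - {a, b}) = {} \<or> outside J \<inter> (P - {a, b}) = {}"
    using inside_outside_intersect_connected[OF arc_between_interior(1)[OF assms(1)], of J] by blast
  ultimately show ?thesis
    using inside_Un_outside[of J] by blast
qed

text \<open>Theta curve argument: \<open>P\<close> cuts \<open>inside (A \<union> B)\<close> into
  \<open>inside (A \<union> P)\<close> and \<open>inside (B \<union> P)\<close>. Being connected,
  the open arc of \<open>Q\<close> stays in one of them, but the closure of the first misses
  \<open>d\<close> and that of the second misses \<open>c\<close>.\<close>

lemma interlaced_chords_not_both_inside:
  assumes A: "arc_between A a b" and B: "arc_between B a b" and AB: "A \<inter> B = {a, b}"
    and c: "c \<in> A - {a, b}" and d: "d \<in> B - {a, b}"
    and P: "arc_between P a b" "P \<inter> (A \<union> B) = {a, b}"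
    and Q: "arc_between Q c d" "Q \<inter> (A \<union> B) = {c, d}"
    and PQ: "P \<inter> Q = {}"
    and Pin: "P - {a, b} \<subseteq> inside (A \<union> B)"
    and Qin: "Q - {c, d} \<subseteq> inside (A \<union> B)"
  shows False
proof -
  obtain g1 where g1: "arc g1" "pathstart g1 = a" "pathfinish g1 = b" "path_image g1 = A"
    using A unfolding arc_between_def by blast
  obtain g2 where g2: "arc g2" "pathstart g2 = a" "pathfinish g2 = b" "path_image g2 = B"
    using B unfolding arc_between_def by blast
  obtain g where g: "arc g" "pathstart g = a" "pathfinish g = b" "path_image g = P"
    using P unfolding arc_between_def by blast
  have AP: "A \<inter> P = {a, b}" and BP: "B \<inter> P = {a, b}"
    using P(2) arc_between_ends[OF A] arc_between_ends[OF B] by auto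
  have ne: "P \<inter> inside (A \<union> B) \<noteq> {}"
    using arc_between_interior(2)[OF P(1)] Pin by blast
  have split: "inside (A \<union> P) \<inter> inside (B \<union> P) = {}"
      "inside (A \<union> P) \<union> inside (B \<union> P) \<union> (P - {a, b}) = inside (A \<union> B)"
    using split_inside_simple_closed_curve[of g1 a b g2 g] g1 g2 g AB AP BP ne
      arc_between_ends[OF A] by (auto simp: arc_imp_simple_path)
  have sc: "simple_closed (A \<union> P)" "simple_closed (B \<union> P)"
    using arc_between_simple_closed A B P(1) AP BP by blast+
  \<comment> \<open>The frontier of the inside is the curve itself, so taking the closure adds only
    points of \<open>J\<close>.\<close>
  have opn: "open (inside J)" and cl: "closure (inside J) \<subseteq> J \<union> inside J" if "simple_closed J" for J
  proof -
    obtain h where "simple_path h" "pathfinish h = pathstart h" "path_image h = J"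
      using \<open>simple_closed J\<close> unfolding simple_closed_def by blast
    then have "open (inside J)" "frontier (inside J) = J"
      using Jordan_inside_outside[of h] by auto
    then show "open (inside J)" "closure (inside J) \<subseteq> J \<union> inside J"
      by (auto simp: frontier_def interior_open)
  qed
  have Qsub: "Q - {c, d} \<subseteq> inside (A \<union> P) \<union> inside (B \<union> P)"
    using Qin split(2) PQ by blast
  have "Q - {c, d} \<subseteq> inside (A \<union> P) \<or> Q - {c, d} \<subseteq> inside (B \<union> P)"
    using connectedD[OF arc_between_interior(1)[OF Q(1)] opn[OF sc(1)] opn[OF sc(2)]] Qsub split(1)
    by blast
  then have "Q \<subseteq> A \<union> P \<union> inside (A \<union> P) \<or> Q \<subseteq> B \<union> P \<union> inside (B \<union> P)"
    using arc_between_interior(3)[OF Q(1)] cl[OF sc(1)] cl[OF sc(2)] closure_mono by (meson order_trans)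
  moreover have "c \<in> Q" "d \<in> Q" using arc_between_ends[OF Q(1)] by auto
  moreover have "c \<notin> P" "d \<notin> P" using \<open>c \<in> Q\<close> \<open>d \<in> Q\<close> PQ by auto
  moreover have "c \<notin> B" "d \<notin> A" using c d AB by auto
  moreover have "c \<notin> inside (A \<union> B)" "d \<notin> inside (A \<union> B)"
    using c d inside_no_overlap[of "A \<union> B"] by blast+
  ultimately show False
    using split(2) by blast
qed

text \<open>Inversion at \<open>w\<close> exchanges points near \<open>w\<close> with points near
  infinity. If the component of the image of \<open>x\<close> were unbounded, its preimage would
  join \<open>x\<close> to points close to \<open>w\<close> without meeting
  \<open>J\<close>.\<close>

lemma inversion_outside:
  assumes J: "compact J" and w: "w \<in> inside J" and x: "x \<in> outside J"
  shows "inverse (x - w) \<in> inside ((\<lambda>z. inverse (z - w :: complex)) ` J)"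
proof -
  define f where "f z = inverse (z - w)" for z :: complex
  define g where "g y = w + inverse y" for y :: complex
  \<comment> \<open>By the convention \<open>inverse 0 = 0\<close>, \<open>f w = 0\<close> and
    \<open>g 0 = w\<close>, so the identities have no exception at the pole.\<close>
  have gf: "g (f z) = z" and fg: "f (g z) = z" for z by (simp_all add: f_def g_def)
  define T where "T = connected_component_set (- (f ` J)) (f x)"
  have wJ: "w \<notin> J" using w inside_no_overlap by blast
  have xJ: "x \<notin> J" using x outside_no_overlap by blast
  have xw: "x \<noteq> w" using w x inside_Int_outside[of J] by blast
  have fx: "f x \<notin> f ` J" using xJ gf by (metis imageE)
  have "bounded T"
  proof (rule ccontr)
    assume unb: "\<not> bounded T"
    have "continuous_on J f" unfolding f_def using wJ by (intro continuous_intros) auto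
    then have clf: "closed (f ` J)" using J compact_continuous_image compact_imp_closed by blast
    have "open T" unfolding T_def using clf by (simp add: open_Compl open_connected_component)
    moreover have "connected T" unfolding T_def by simp
    \<comment> \<open>The point \<open>0\<close>, the limit of \<open>f\<close> at infinity, is
      removed because \<open>g\<close> is not continuous there; an open connected subset of the
      plane stays connected without it.\<close>
    ultimately have conT: "connected (T - {0})"
      by (intro connected_open_delete) auto
    have "continuous_on (T - {0}) g" unfolding g_def by (intro continuous_intros) auto
    then have con: "connected (g ` (T - {0}))" using conT connected_continuous_image by blast
    have "open (inside J)" using J by (simp add: open_inside compact_imp_closed)
    then obtain e where e: "e > 0" "ball w e \<subseteq> inside J" using w open_contains_ball by blast
    obtain y where y: "y \<in> T" "norm y > 1 / e"
      using unb unfolding bounded_iff by (meson not_le)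
    have y0: "y \<noteq> 0" using y(2) e(1) by auto
    have "norm (inverse y) < e"
      unfolding norm_inverse using y(2) e(1) y0 by (simp add: field_simps)
    then have "g y \<in> inside J" using e(2) by (auto simp: g_def dist_norm)
    then have "inside J \<inter> g ` (T - {0}) \<noteq> {}" using y(1) y0 by blast
    moreover have "f x \<in> T - {0}"
      using fx xw by (simp add: T_def) (simp add: f_def)
    then have "outside J \<inter> g ` (T - {0}) \<noteq> {}" using x gf by (metis IntI empty_iff imageI)
    ultimately have "J \<inter> g ` (T - {0}) \<noteq> {}"
      using inside_outside_intersect_connected[OF con] by blast
    then obtain z where "z \<in> T" "g z \<in> J" by blast
    then have "z \<in> f ` J" using fg by (metis imageI)
    moreover have "T \<subseteq> - f ` J" unfolding T_def by (rule connected_component_subset)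
    ultimately show False using \<open>z \<in> T\<close> by blast
  qed
  then show ?thesis
    using fx unfolding inside_def T_def f_def by auto
qed

text \<open>Inversion at a point \<open>w\<close> of the inside turns both chords into inside chords
  of the image curve. They remain arcs, since \<open>w\<close> lies on neither.\<close>

lemma interlaced_chords_not_both_outside:
  assumes A: "arc_between A a b" and B: "arc_between B a b" and AB: "A \<inter> B = {a, b}"
    and c: "c \<in> A - {a, b}" and d: "d \<in> B - {a, b}"
    and P: "arc_between P a b" "P \<inter> (A \<union> B) = {a, b}"
    and Q: "arc_between Q c d" "Q \<inter> (A \<union> B) = {c, d}"
    and PQ: "P \<inter> Q = {}"
    and Pout: "P - {a, b} \<subseteq> outside (A \<union> B)"
    and Qout: "Q - {c, d} \<subseteq> outside (A \<union> B)"
  shows False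
proof -
  define J where "J = A \<union> B"
  obtain h where h: "simple_path h" "pathfinish h = pathstart h" "path_image h = J"
    using arc_between_simple_closed[OF A B AB] unfolding simple_closed_def J_def by blast
  have J: "compact J" using h compact_simple_path_image by blast
  obtain w where w: "w \<in> inside J" using Jordan_inside_outside[OF h(1,2)] h(3) by blast
  define f where "f z = inverse (z - w)" for z
  \<comment> \<open>Injective on the whole plane because \<open>inverse 0 = 0\<close>; hence
    \<open>f\<close> commutes with intersections and differences.\<close>
  have inj: "inj f" unfolding f_def inj_def by simp
  have wJ: "w \<notin> J" using w inside_no_overlap by blast
  have "w \<notin> outside J" using w inside_Int_outside[of J] by blast
  then have wPQ: "w \<notin> P" "w \<notin> Q"
    using wJ Pout Qout P(2) Q(2) unfolding J_def by blast+
  have im: "arc_between (f ` S) (f u) (f v)" if "arc_between S u v" "w \<notin> S" for S u v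
    using that(1)
  proof (rule arc_between_image)
    show "continuous_on S f" unfolding f_def using that(2) by (intro continuous_intros) auto
    show "inj_on f S" using inj inj_on_subset by blast
  qed
  have ins: "f ` S \<subseteq> inside (f ` J)" if "S \<subseteq> outside J" for S
    using inversion_outside[OF J w] that unfolding f_def by blast
  have un: "f ` A \<union> f ` B = f ` J" by (auto simp: J_def)
  have int: "f ` S \<inter> f ` T = f ` (S \<inter> T)" for S T
    using inj by (simp add: image_Int)
  have diff: "f ` S - {f u, f v} = f ` (S - {u, v})" for S u v
    using inj by (auto simp: inj_eq)
  show False
  proof (rule interlaced_chords_not_both_inside[of "f ` A" "f a" "f b" "f ` B" "f c" "f d" "f ` P" "f ` Q"])
    show "arc_between (f ` A) (f a) (f b)" "arc_between (f ` B) (f a) (f b)"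
      using im A B wJ by (auto simp: J_def)
    show "arc_between (f ` P) (f a) (f b)" "arc_between (f ` Q) (f c) (f d)"
      using im P(1) Q(1) wPQ by auto
    show "f ` A \<inter> f ` B = {f a, f b}" "f ` P \<inter> (f ` A \<union> f ` B) = {f a, f b}"
      "f ` Q \<inter> (f ` A \<union> f ` B) = {f c, f d}" "f ` P \<inter> f ` Q = {}"
      using AB P(2) Q(2) PQ by (simp_all add: un int) (simp_all add: J_def)
    show "f c \<in> f ` A - {f a, f b}" "f d \<in> f ` B - {f a, f b}"
      using c d by (auto simp: diff)
    show "f ` P - {f a, f b} \<subseteq> inside (f ` A \<union> f ` B)"
      "f ` Q - {f c, f d} \<subseteq> inside (f ` A \<union> f ` B)"
      using ins Pout Qout unfolding un diff J_def by blast+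
  qed
qed

text \<open>Stated as an equivalence with a negation, so that an odd cycle of interlaced chords
  becomes a propositional contradiction.\<close>

lemma interlaced_chords_separated:
  assumes A: "arc_between A a b" and B: "arc_between B a b" and AB: "A \<inter> B = {a, b}"
    and c: "c \<in> A - {a, b}" and d: "d \<in> B - {a, b}"
    and P: "arc_between P a b" "P \<inter> (A \<union> B) = {a, b}"
    and Q: "arc_between Q c d" "Q \<inter> (A \<union> B) = {c, d}"
    and PQ: "P \<inter> Q = {}"
  shows "P - {a, b} \<subseteq> inside (A \<union> B) \<longleftrightarrow> \<not> Q - {c, d} \<subseteq> inside (A \<union> B)"
  using interlaced_chords_not_both_inside[OF assms] interlaced_chords_not_both_outside[OF assms]
    chord_inside_or_outside[OF P] chord_inside_or_outside[OF Q] by blast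

section \<open>Arcs of a plane drawing\<close>

definition edge_image :: "('a set \<Rightarrow> real \<Rightarrow> complex) \<Rightarrow> 'a \<Rightarrow> 'a \<Rightarrow> complex set" where
  "edge_image \<gamma> u v = path_image (\<gamma> {u, v})"

lemma edge_image_commute: "edge_image \<gamma> u v = edge_image \<gamma> v u"
  by (simp add: edge_image_def insert_commute)

lemma edge_image_arc:
  assumes "plane_drawing G p \<gamma>" "{u, v} \<in> edges G"
  shows "arc_between (edge_image \<gamma> u v) (p u) (p v)"
proof -
  have "arc (\<gamma> {u, v})" "{pathstart (\<gamma> {u, v}), pathfinish (\<gamma> {u, v})} = {p u, p v}"
    using assms unfolding plane_drawing_def by auto
  \<comment> \<open>The drawing fixes only the unordered pair of ends, so the path may run either
    way.\<close>
  then have "arc_between (edge_image \<gamma> u v) (p u) (p v) \<or> arc_between (edge_image \<gamma> u v) (p v) (p u)"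
    unfolding arc_between_def edge_image_def doubleton_eq_iff by blast
  then show ?thesis using arc_between_sym by blast
qed

text \<open>The drawing gives one inclusion; common ends lie on both arcs, which gives the other. As
  an equation it lets the simplifier compute all intersections of boundary paths and chords.\<close>

lemma edge_image_Int:
  assumes "plane_drawing G p \<gamma>" "{u, v} \<in> edges G" "{u', v'} \<in> edges G" "{u, v} \<noteq> {u', v'}"
  shows "edge_image \<gamma> u v \<inter> edge_image \<gamma> u' v' = p ` ({u, v} \<inter> {u', v'})"
proof
  show "edge_image \<gamma> u v \<inter> edge_image \<gamma> u' v' \<subseteq> p ` ({u, v} \<inter> {u', v'})"
    using assms(1)[unfolded plane_drawing_def, THEN conjunct2, THEN conjunct2,
        rule_format, OF assms(2-4)] by (simp only: edge_image_def)
  show "p ` ({u, v} \<inter> {u', v'}) \<subseteq> edge_image \<gamma> u v \<inter> edge_image \<gamma> u' v'"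
    using arc_between_ends[OF edge_image_arc[OF assms(1,2)]]
      arc_between_ends[OF edge_image_arc[OF assms(1,3)]] by auto
qed

section \<open>Two non-planar graphs\<close>

text \<open>\<open>v1\<close> and \<open>v3\<close> cut the pentagon into a path through
  \<open>v2\<close> and a path through \<open>v4\<close>, so the two chords are interlaced.
  \<open>J\<close> is given by an equation so that all rotations can refer to one curve.\<close>

lemma pentagon_chords_separated:
  assumes d: "plane_drawing G p \<gamma>"
    and dist: "distinct [v1, v2, v3, v4, v5]"
    and V: "{v1, v2, v3, v4, v5} \<subseteq> verts G"
    and e: "{v1, v2} \<in> edges G" "{v2, v3} \<in> edges G" "{v3, v4} \<in> edges G" "{v4, v5} \<in> edges G"
      "{v5, v1} \<in> edges G" "{v1, v3} \<in> edges G" "{v2, v4} \<in> edges G"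
    and J: "J = edge_image \<gamma> v1 v2 \<union> edge_image \<gamma> v2 v3 \<union> edge_image \<gamma> v3 v4
      \<union> edge_image \<gamma> v4 v5 \<union> edge_image \<gamma> v5 v1"
  shows "edge_image \<gamma> v1 v3 - {p v1, p v3} \<subseteq> inside J
    \<longleftrightarrow> \<not> edge_image \<gamma> v2 v4 - {p v2, p v4} \<subseteq> inside J"
proof -
  \<comment> \<open>The reversed list supplies the simplifier with each inequality in the other
    orientation.\<close>
  have dist': "distinct [v5, v4, v3, v2, v1]" using dist by auto
  have inj: "inj_on p {v1, v2, v3, v4, v5}"
    using d[unfolded plane_drawing_def, THEN conjunct1] V by (rule inj_on_subset)
  define E where "E = edge_image \<gamma>"
  note a = e[THEN edge_image_arc[OF d], folded E_def]
  have I: "E u v \<inter> E u' v' = p ` ({u, v} \<inter> {u', v'})"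
    if "{u, v} \<in> edges G" "{u', v'} \<in> edges G" "{u, v} \<noteq> {u', v'}" for u v u' v'
    using edge_image_Int[OF d that] by (simp add: E_def)
  have pd: "distinct (map p [v1, v2, v3, v4, v5])"
    using inj dist by (simp add: distinct_map)
  have A: "arc_between (E v1 v2 \<union> E v2 v3) (p v1) (p v3)"
    using a(1,2) by (rule arc_between_Un) (use dist dist' in \<open>simp add: I e doubleton_eq_iff\<close>)
  have B1: "arc_between (E v3 v4 \<union> E v4 v5) (p v3) (p v5)"
    using a(3,4) by (rule arc_between_Un) (use dist dist' in \<open>simp add: I e doubleton_eq_iff\<close>)
  have B: "arc_between (E v3 v4 \<union> E v4 v5 \<union> E v5 v1) (p v3) (p v1)"
    using B1 a(5) by (rule arc_between_Un) (use dist dist' in \<open>simp add: I e doubleton_eq_iff Int_Un_distrib2\<close>)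
  have J': "J = (E v1 v2 \<union> E v2 v3) \<union> (E v3 v4 \<union> E v4 v5 \<union> E v5 v1)"
    unfolding J E_def by blast
  show ?thesis
    unfolding J' E_def[symmetric]
  proof (rule interlaced_chords_separated[OF A arc_between_sym[OF B] _ _ _ a(6) _ a(7)])
    show "(E v1 v2 \<union> E v2 v3) \<inter> (E v3 v4 \<union> E v4 v5 \<union> E v5 v1) = {p v1, p v3}"
      using dist dist' by (auto simp: I e doubleton_eq_iff Int_Un_distrib2 Int_Un_distrib)
    show "p v2 \<in> E v1 v2 \<union> E v2 v3 - {p v1, p v3}" "p v4 \<in> E v3 v4 \<union> E v4 v5 \<union> E v5 v1 - {p v1, p v3}"
      using a[THEN arc_between_ends] pd by auto
    show "E v1 v3 \<inter> (E v1 v2 \<union> E v2 v3 \<union> (E v3 v4 \<union> E v4 v5 \<union> E v5 v1)) = {p v1, p v3}"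
      using dist dist' by (auto simp: I e doubleton_eq_iff Int_Un_distrib2 Int_Un_distrib)
    show "E v2 v4 \<inter> (E v1 v2 \<union> E v2 v3 \<union> (E v3 v4 \<union> E v4 v5 \<union> E v5 v1)) = {p v2, p v4}"
      using dist dist' by (auto simp: I e doubleton_eq_iff Int_Un_distrib2 Int_Un_distrib)
    show "E v1 v3 \<inter> E v2 v4 = {}"
      using dist dist' by (simp add: I e doubleton_eq_iff)
  qed
qed


text \<open>\<open>v1\<close> and \<open>v4\<close> cut the hexagon into two paths of three edges,
  with \<open>v2\<close> on one and \<open>v5\<close> on the other.\<close>

lemma hexagon_chords_separated:
  assumes d: "plane_drawing G p \<gamma>"
    and dist: "distinct [v1, v2, v3, v4, v5, v6]"
    and V: "{v1, v2, v3, v4, v5, v6} \<subseteq> verts G"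
    and e: "{v1, v2} \<in> edges G" "{v2, v3} \<in> edges G" "{v3, v4} \<in> edges G" "{v4, v5} \<in> edges G"
      "{v5, v6} \<in> edges G" "{v6, v1} \<in> edges G" "{v1, v4} \<in> edges G" "{v2, v5} \<in> edges G"
    and J: "J = edge_image \<gamma> v1 v2 \<union> edge_image \<gamma> v2 v3 \<union> edge_image \<gamma> v3 v4
      \<union> edge_image \<gamma> v4 v5 \<union> edge_image \<gamma> v5 v6 \<union> edge_image \<gamma> v6 v1"
  shows "edge_image \<gamma> v1 v4 - {p v1, p v4} \<subseteq> inside J
    \<longleftrightarrow> \<not> edge_image \<gamma> v2 v5 - {p v2, p v5} \<subseteq> inside J"
proof -
  have dist': "distinct [v6, v5, v4, v3, v2, v1]" using dist by auto
  have inj: "inj_on p {v1, v2, v3, v4, v5, v6}"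
    using d[unfolded plane_drawing_def, THEN conjunct1] V by (rule inj_on_subset)
  define E where "E = edge_image \<gamma>"
  note a = e[THEN edge_image_arc[OF d], folded E_def]
  have I: "E u v \<inter> E u' v' = p ` ({u, v} \<inter> {u', v'})"
    if "{u, v} \<in> edges G" "{u', v'} \<in> edges G" "{u, v} \<noteq> {u', v'}" for u v u' v'
    using edge_image_Int[OF d that] by (simp add: E_def)
  have pd: "distinct (map p [v1, v2, v3, v4, v5, v6])"
    using inj dist by (simp add: distinct_map)
  have A1: "arc_between (E v1 v2 \<union> E v2 v3) (p v1) (p v3)"
    using a(1,2) by (rule arc_between_Un) (use dist dist' in \<open>simp add: I e doubleton_eq_iff\<close>)
  have A: "arc_between (E v1 v2 \<union> E v2 v3 \<union> E v3 v4) (p v1) (p v4)"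
    using A1 a(3) by (rule arc_between_Un) (use dist dist' in \<open>simp add: I e doubleton_eq_iff Int_Un_distrib2\<close>)
  have B1: "arc_between (E v4 v5 \<union> E v5 v6) (p v4) (p v6)"
    using a(4,5) by (rule arc_between_Un) (use dist dist' in \<open>simp add: I e doubleton_eq_iff\<close>)
  have B: "arc_between (E v4 v5 \<union> E v5 v6 \<union> E v6 v1) (p v4) (p v1)"
    using B1 a(6) by (rule arc_between_Un) (use dist dist' in \<open>simp add: I e doubleton_eq_iff Int_Un_distrib2\<close>)
  have J': "J = (E v1 v2 \<union> E v2 v3 \<union> E v3 v4) \<union> (E v4 v5 \<union> E v5 v6 \<union> E v6 v1)"
    unfolding J E_def by blast
  show ?thesis
    unfolding J' E_def[symmetric]
  proof (rule interlaced_chords_separated[OF A arc_between_sym[OF B] _ _ _ a(7) _ a(8)])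
    show "(E v1 v2 \<union> E v2 v3 \<union> E v3 v4) \<inter> (E v4 v5 \<union> E v5 v6 \<union> E v6 v1) = {p v1, p v4}"
      using dist dist' by (auto simp: I e doubleton_eq_iff Int_Un_distrib2 Int_Un_distrib)
    show "p v2 \<in> E v1 v2 \<union> E v2 v3 \<union> E v3 v4 - {p v1, p v4}"
      "p v5 \<in> E v4 v5 \<union> E v5 v6 \<union> E v6 v1 - {p v1, p v4}"
      using a[THEN arc_between_ends] pd by auto
    show "E v1 v4 \<inter> (E v1 v2 \<union> E v2 v3 \<union> E v3 v4 \<union> (E v4 v5 \<union> E v5 v6 \<union> E v6 v1)) = {p v1, p v4}"
      using dist dist' by (auto simp: I e doubleton_eq_iff Int_Un_distrib2 Int_Un_distrib)
    show "E v2 v5 \<inter> (E v1 v2 \<union> E v2 v3 \<union> E v3 v4 \<union> (E v4 v5 \<union> E v5 v6 \<union> E v6 v1)) = {p v2, p v5}"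
      using dist dist' by (auto simp: I e doubleton_eq_iff Int_Un_distrib2 Int_Un_distrib)
    show "E v1 v4 \<inter> E v2 v5 = {}"
      using dist dist' by (simp add: I e doubleton_eq_iff)
  qed
qed

text \<open>In the cyclic order \<open>v1 v3\<close>, \<open>v2 v4\<close>, \<open>v3 v5\<close>,
  \<open>v4 v1\<close>, \<open>v5 v2\<close> each diagonal is separated from the next by a rotated
  instance of the pentagon lemma. This would 2-colour a 5-cycle.\<close>

lemma not_planar_if_contains_complete_5:
  assumes dist: "distinct [v1, v2, v3, v4, v5]"
    and V: "{v1, v2, v3, v4, v5} \<subseteq> verts G"
    and e: "\<And>u v. u \<in> {v1, v2, v3, v4, v5} \<Longrightarrow> v \<in> {v1, v2, v3, v4, v5} \<Longrightarrow> u \<noteq> v \<Longrightarrow> {u, v} \<in> edges G"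
  shows "\<not> planar G"
proof
  have dist': "distinct [v5, v4, v3, v2, v1]" using dist by auto
  assume "planar G"
  then obtain p \<gamma> where d: "plane_drawing G p \<gamma>" unfolding planar_def by blast
  define J where "J = edge_image \<gamma> v1 v2 \<union> edge_image \<gamma> v2 v3 \<union> edge_image \<gamma> v3 v4
      \<union> edge_image \<gamma> v4 v5 \<union> edge_image \<gamma> v5 v1"
  define side where "side u v \<longleftrightarrow> edge_image \<gamma> u v - {p u, p v} \<subseteq> inside J" for u v
  have "side v1 v3 \<noteq> side v2 v4"
    using pentagon_chords_separated[OF d, of v1 v2 v3 v4 v5 J] dist dist' V e
    by (simp add: side_def J_def)
  moreover have "side v2 v4 \<noteq> side v3 v5"
    using pentagon_chords_separated[OF d, of v2 v3 v4 v5 v1 J] dist dist' V e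
    by (simp add: side_def J_def Un_ac)
  moreover have "side v3 v5 \<noteq> side v4 v1"
    using pentagon_chords_separated[OF d, of v3 v4 v5 v1 v2 J] dist dist' V e
    by (simp add: side_def J_def Un_ac)
  moreover have "side v4 v1 \<noteq> side v5 v2"
    using pentagon_chords_separated[OF d, of v4 v5 v1 v2 v3 J] dist dist' V e
    by (simp add: side_def J_def Un_ac)
  moreover have "side v5 v2 \<noteq> side v1 v3"
    using pentagon_chords_separated[OF d, of v5 v1 v2 v3 v4 J] dist dist' V e
    by (simp add: side_def J_def Un_ac)
  ultimately show False by blast
qed

text \<open>A hexagon alternating between the classes uses six of the nine edges; the other three
  are its long diagonals, which would lie on pairwise different sides.\<close>

lemma not_planar_if_contains_complete_bipartite_3_3:
  assumes dist: "distinct [a1, a2, a3, b1, b2, b3]"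
    and V: "{a1, a2, a3, b1, b2, b3} \<subseteq> verts G"
    and e: "\<And>a b. a \<in> {a1, a2, a3} \<Longrightarrow> b \<in> {b1, b2, b3} \<Longrightarrow> {a, b} \<in> edges G"
  shows "\<not> planar G"
proof
  have dist': "distinct [b3, b2, b1, a3, a2, a1]" using dist by auto
  assume "planar G"
  then obtain p \<gamma> where d: "plane_drawing G p \<gamma>" unfolding planar_def by blast
  have e': "{b, a} \<in> edges G" if "a \<in> {a1, a2, a3}" "b \<in> {b1, b2, b3}" for a b
    using e[OF that] by (simp add: insert_commute)
  define J where "J = edge_image \<gamma> a1 b1 \<union> edge_image \<gamma> b1 a2 \<union> edge_image \<gamma> a2 b2
      \<union> edge_image \<gamma> b2 a3 \<union> edge_image \<gamma> a3 b3 \<union> edge_image \<gamma> b3 a1"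
  define side where "side u v \<longleftrightarrow> edge_image \<gamma> u v - {p u, p v} \<subseteq> inside J" for u v
  \<comment> \<open>The third rotation names a diagonal from its other end, as \<open>b2 a1\<close>
    instead of \<open>a1 b2\<close>.\<close>
  have side_sym: "side u v = side v u" for u v
    unfolding side_def by (simp add: edge_image_commute[of \<gamma> u v] insert_commute)
  have "side a1 b2 \<noteq> side b1 a3"
    using hexagon_chords_separated[OF d, of a1 b1 a2 b2 a3 b3 J] dist dist' V e e'
    by (simp add: side_def J_def)
  moreover have "side b1 a3 \<noteq> side a2 b3"
    using hexagon_chords_separated[OF d, of b1 a2 b2 a3 b3 a1 J] dist dist' V e e'
    by (simp add: side_def J_def Un_ac)
  moreover have "side a2 b3 \<noteq> side b2 a1"
    using hexagon_chords_separated[OF d, of a2 b2 a3 b3 a1 b1 J] dist dist' V e e'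
    by (simp add: side_def J_def Un_ac)
  ultimately show False using side_sym[of a1 b2] by blast
qed

text \<open>Pulls the six vertices back along the inverse isomorphism, so that adjacency is checked
  only in the explicit graph \<open>H\<close>.\<close>

lemma not_planar_if_isomorphic_contains_complete_bipartite_3_3:
  assumes iso: "graph_isomorphic G H"
    and dist: "distinct [a1, a2, a3, b1, b2, b3]"
    and V: "{a1, a2, a3, b1, b2, b3} \<subseteq> verts H"
    and e: "\<And>a b. a \<in> {a1, a2, a3} \<Longrightarrow> b \<in> {b1, b2, b3} \<Longrightarrow> {a, b} \<in> edges H"
  shows "\<not> planar G"
proof -
  obtain f where f: "bij_betw f (verts G) (verts H)"
    and fe: "\<And>u v. u \<in> verts G \<Longrightarrow> v \<in> verts G \<Longrightarrow> {u, v} \<in> edges G \<longleftrightarrow> {f u, f v} \<in> edges H"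
    using iso unfolding graph_isomorphic_def by blast
  define g where "g = inv_into (verts G) f"
  have g: "bij_betw g (verts H) (verts G)"
    unfolding g_def using f by (rule bij_betw_inv_into)
  have gV: "g u \<in> verts G" if "u \<in> {a1, a2, a3, b1, b2, b3}" for u
    using g V that by (meson bij_betwE subsetD)
  have fg: "f (g u) = u" if "u \<in> {a1, a2, a3, b1, b2, b3}" for u
    unfolding g_def using f V that by (meson bij_betw_inv_into_right subsetD)
  have inj: "inj_on g {a1, a2, a3, b1, b2, b3}"
    using bij_betw_imp_inj_on[OF g] V by (rule inj_on_subset)
  show ?thesis
  proof (rule not_planar_if_contains_complete_bipartite_3_3)
    have "distinct (map g [a1, a2, a3, b1, b2, b3])"
      using inj dist by (simp only: distinct_map list.set simp_thms)
    then show "distinct [g a1, g a2, g a3, g b1, g b2, g b3]" by simp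
    show "{g a1, g a2, g a3, g b1, g b2, g b3} \<subseteq> verts G" using gV by blast
    fix a b assume "a \<in> {g a1, g a2, g a3}" "b \<in> {g b1, g b2, g b3}"
    then obtain a' b' where ab: "a' \<in> {a1, a2, a3}" "b' \<in> {b1, b2, b3}" "a = g a'" "b = g b'"
      by blast
    have "f a = a'" "f b = b'" "a \<in> verts G" "b \<in> verts G"
      unfolding ab(3,4) using ab(1,2) by (intro fg gV; blast)+
    then show "{a, b} \<in> edges G" using fe[of a b] e[OF ab(1,2)] by simp
  qed
qed

section \<open>Irreducible ideals and their graphs\<close>

text \<open>This is \<open>B(x)\<close>; the witness \<open>z\<close> avoids subtraction, which is
  truncated on \<open>nat\<close>.\<close>

definition divisors_in :: "nat set \<Rightarrow> nat \<Rightarrow> nat set" where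
  "divisors_in L x = {y \<in> L. \<exists>z\<in>L. y + z = x}"

lemma finite_divisors_in: "finite (divisors_in L x)"
  by (rule finite_subset[of _ "{..x}"]) (auto simp: divisors_in_def)

lemma divisors_in_minus:
  assumes "w \<in> divisors_in L x"
  shows "x - w \<in> divisors_in L x" and "w \<le> x"
  using assms by (auto simp: divisors_in_def add.commute)

text \<open>If \<open>i + s\<close> divides \<open>x\<close>, so does \<open>i\<close>, hence the
  complement absorbs \<open>L\<close>. It is nonempty because \<open>L\<close> is infinite and
  \<open>B(x)\<close> finite, and proper because it omits \<open>0\<close>.\<close>

lemma proper_ideal_Diff_divisors_in:
  assumes L: "numerical_semigroup L" and x: "x \<in> L"
  shows "proper_ideal L (L - divisors_in L x)"
proof -
  have z: "0 \<in> L" and pl: "\<And>x y. x \<in> L \<Longrightarrow> y \<in> L \<Longrightarrow> x + y \<in> L" and "finite (UNIV - L)"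
    using L by (auto simp: numerical_semigroup_def)
  then have "infinite L"
    by (metis finite_Diff2 infinite_UNIV_nat)
  then have "L - divisors_in L x \<noteq> {}"
    by (metis Diff_eq_empty_iff finite_divisors_in finite_subset)
  moreover have "i + s \<in> L - divisors_in L x" if "i \<in> L - divisors_in L x" "s \<in> L" for i s
    using that pl unfolding divisors_in_def by (auto simp: add.assoc)
  moreover have "0 \<in> divisors_in L x" using z x by (simp add: divisors_in_def)
  ultimately show ?thesis
    using z unfolding proper_ideal_def semigroup_ideal_def by blast
qed

text \<open>Barucci's theorem. For \<open>x\<close> in \<open>L - I\<close>, absorption keeps
  \<open>B(x)\<close> disjoint from \<open>I\<close>, while \<open>x\<close> itself is in
  \<open>B(x)\<close>; so \<open>I\<close> is the intersection of all these complements. If none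
  equals \<open>I\<close>, this contradicts irreducibility.\<close>

lemma irreducible_ideal_eq_Diff_divisors_in:
  assumes L: "numerical_semigroup L" and I: "irreducible_ideal L I"
  shows "\<exists>x\<in>L. I = L - divisors_in L x"
proof (rule ccontr)
  assume neg: "\<not> (\<exists>x\<in>L. I = L - divisors_in L x)"
  have z: "0 \<in> L" and fin: "finite (UNIV - L)"
    using L by (auto simp: numerical_semigroup_def)
  have I': "I \<noteq> {}" "I \<subseteq> L" "I \<noteq> L" and abs: "\<And>i s. i \<in> I \<Longrightarrow> s \<in> L \<Longrightarrow> i + s \<in> I"
    and irr: "\<And>F. card F \<ge> 2 \<Longrightarrow> \<forall>J\<in>F. proper_ideal L J \<and> I \<subset> J \<Longrightarrow> I \<noteq> \<Inter>F"
    using I unfolding irreducible_ideal_def proper_ideal_def semigroup_ideal_def by blast+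
  obtain i where i: "i \<in> I" using I'(1) by blast
  \<comment> \<open>With \<open>i\<close> in \<open>I\<close> fixed, an element \<open>m\<close> of
    \<open>L - I\<close> with \<open>m \<ge> i\<close> is \<open>i\<close> plus a gap of
    \<open>L\<close>, and there are finitely many gaps.\<close>
  have "L - I \<subseteq> {..<i} \<union> (+) i ` (UNIV - L)"
  proof
    fix m assume m: "m \<in> L - I"
    show "m \<in> {..<i} \<union> (+) i ` (UNIV - L)"
    proof (cases "m < i")
      case False
      then have "m = i + (m - i)" by simp
      moreover from this have "m - i \<notin> L" using abs[OF i] m by (metis DiffD2)
      ultimately show ?thesis by blast
    qed simp
  qed
  then have finD: "finite (L - I)" using fin by (meson finite_UnI finite_imageI finite_lessThan finite_subset)
  define F where "F = (\<lambda>x. L - divisors_in L x) ` (L - I)"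
  have sub: "I \<subseteq> L - divisors_in L x" if "x \<in> L - I" for x
    using that I'(2) abs unfolding divisors_in_def by blast
  have self: "x \<in> divisors_in L x" if "x \<in> L" for x
    using that z unfolding divisors_in_def by force
  have F: "\<forall>J\<in>F. proper_ideal L J \<and> I \<subset> J"
    using proper_ideal_Diff_divisors_in[OF L] sub neg unfolding F_def by blast
  have ne: "L - I \<noteq> {}" using I' by blast
  have eq: "I = \<Inter>F"
    using sub self ne I'(2) unfolding F_def by blast
  \<comment> \<open>\<open>card\<close> is 0 on empty and on infinite families, so both are
    excluded; the member of a one-element family would equal \<open>I\<close>.\<close>
  have "finite F" "F \<noteq> {}" using finD ne by (auto simp: F_def)
  then have "card F \<noteq> 0" by simp
  moreover have "card F \<noteq> 1"
    using F eq by (auto simp: card_1_singleton_iff)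
  ultimately have "card F \<ge> 2" by linarith
  then show False using irr F eq by blast
qed

section \<open>Sums of the largest elements of \<open>B(x)\<close>\<close>

lemma ex_upper_subset_card:
  fixes S :: "'a :: linorder set"
  assumes "finite S" "n \<le> card S"
  shows "\<exists>T\<subseteq>S. card T = n \<and> (\<forall>s\<in>S - T. \<forall>t\<in>T. s < t)"
  using assms(2)
proof (induction n)
  case 0
  show ?case by (intro exI[of _ "{}"]) simp
next
  case (Suc n)
  then obtain T where T: "T \<subseteq> S" "card T = n" "\<forall>s\<in>S - T. \<forall>t\<in>T. s < t" by auto
  have fT: "finite T" using T(1) assms(1) finite_subset by blast
  have ne: "S - T \<noteq> {}" using T Suc.prems by (metis Diff_eq_empty_iff Suc_n_not_le_n subset_antisym)
  define m where "m = Max (S - T)"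
  have m: "m \<in> S - T" unfolding m_def using ne assms(1) by (intro Max_in) auto
  have less: "s < m" if "s \<in> S - insert m T" for s
    using that assms(1) by (auto simp: m_def less_le)
  show ?case
    using T m less fT by (intro exI[of _ "insert m T"]) auto
qed

text \<open>If \<open>u + v\<close> were in \<open>B(x)\<close>, then
  \<open>w \<mapsto> x - w\<close> would send the elements up to \<open>v\<close> injectively to
  elements at least \<open>u\<close>, hence into \<open>T\<close>: at most 5. Those above
  \<open>v\<close> lie in \<open>T - {u, v}\<close>: at most 3. But \<open>B(x)\<close> has at least
  9 elements.\<close>

lemma sum_of_upper_divisors:
  assumes L: "numerical_semigroup L" and x: "x \<in> L"
    and T: "T \<subseteq> divisors_in L x - {0}" "card T = 5"
    and upper: "\<forall>s\<in>divisors_in L x - {0} - T. \<forall>t\<in>T. s < t"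
    and card: "card (divisors_in L x - {0}) \<ge> 8"
    and uv: "u \<in> T" "v \<in> T" "u < v"
  shows "u + v \<notin> divisors_in L x"
proof
  assume "u + v \<in> divisors_in L x"
  then have le: "u + v \<le> x" by (rule divisors_in_minus)
  define B where "B = divisors_in L x"
  have fB: "finite B" unfolding B_def by (rule finite_divisors_in)
  have fT: "finite T" using T(1) finite_divisors_in by (meson finite_Diff finite_subset)
  have u0: "0 < u" using subsetD[OF T(1) uv(1)] by simp
  have up: "s \<in> T" if "s \<in> B" "t \<in> T" "t \<le> s" "0 < s" for s t
  proof (rule ccontr)
    assume "s \<notin> T"
    then have "s \<in> divisors_in L x - {0} - T" using that by (simp add: B_def)
    then have "s < t" using upper that(2) by blast
    then show False using that(3) by simp
  qed
  have "card {w \<in> B. w \<le> v} = card ((\<lambda>w. x - w) ` {w \<in> B. w \<le> v})"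
  proof (rule card_image[symmetric])
    \<comment> \<open>Truncated subtraction from \<open>x\<close> is injective only on arguments up
      to \<open>x\<close>.\<close>
    have "{w \<in> B. w \<le> v} \<subseteq> {..x}" unfolding B_def using divisors_in_minus(2) by blast
    moreover have "inj_on (\<lambda>w. x - w) {..x}" by (rule inj_onI) auto
    ultimately show "inj_on (\<lambda>w. x - w) {w \<in> B. w \<le> v}" by (rule inj_on_subset[rotated])
  qed
  also have "\<dots> \<le> card T"
  proof (rule card_mono[OF fT], rule image_subsetI)
    fix w assume w: "w \<in> {w \<in> B. w \<le> v}"
    then have "x - w \<in> B"
      unfolding B_def using divisors_in_minus(1) by blast
    moreover have "u \<le> x - w" using w le by auto
    ultimately show "x - w \<in> T" using up uv(1) u0 by (meson less_le_trans)
  qed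
  finally have low: "card {w \<in> B. w \<le> v} \<le> 5" using T(2) by simp
  have "{w \<in> B. v < w} \<subseteq> T - {u, v}"
    using up[OF _ uv(2)] uv(3) by (auto simp: less_imp_le)
  then have "card {w \<in> B. v < w} \<le> card (T - {u, v})" using fT by (intro card_mono) auto
  also have "\<dots> = 3" using fT uv T(2) by (simp add: card_Diff_subset)
  finally have high: "card {w \<in> B. v < w} \<le> 3" .
  \<comment> \<open>\<open>0\<close> is no vertex but counts in \<open>B\<close>, which raises the
    bound from 8 to 9.\<close>
  have "0 \<in> B" using L x by (simp add: B_def divisors_in_def numerical_semigroup_def)
  then have "card B \<ge> 9" using card fB unfolding B_def by (simp add: card_Diff_singleton)
  moreover have "B = {w \<in> B. w \<le> v} \<union> {w \<in> B. v < w}" by auto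
  then have "card B \<le> card {w \<in> B. w \<le> v} + card {w \<in> B. v < w}" by (metis card_Un_le)
  ultimately show False using low high by simp
qed

lemma divisors_graph_not_planar:
  assumes L: "numerical_semigroup L" and x: "x \<in> L"
    and order: "graph_order (ideal_graph L (L - divisors_in L x)) \<ge> 8"
  shows "\<not> planar (ideal_graph L (L - divisors_in L x))"
proof -
  define B where "B = divisors_in L x"
  have BL: "B \<subseteq> L" unfolding B_def divisors_in_def by blast
  have verts: "verts (ideal_graph L (L - B)) = B - {0}"
    using BL by (auto simp: ideal_graph_def)
  \<comment> \<open>The sum stays in \<open>L\<close>, so adjacency only asks that it leave
    \<open>B\<close>.\<close>
  have edges: "{u, v} \<in> edges (ideal_graph L (L - B))"
    if "u \<in> B - {0}" "v \<in> B - {0}" "u \<noteq> v" "u + v \<notin> B" for u v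
  proof -
    have "u + v \<in> L - B"
      using that BL L unfolding numerical_semigroup_def by blast
    moreover have "L - (L - B) = B" using BL by blast
    ultimately show ?thesis
      unfolding ideal_graph_def simple_graph.simps using that(1-3) by auto
  qed
  have card: "card (B - {0}) \<ge> 8" using order verts by (simp add: graph_order_def B_def)
  have "finite (B - {0})" unfolding B_def using finite_divisors_in by blast
  then obtain T where T: "T \<subseteq> B - {0}" "card T = 5" "\<forall>s\<in>B - {0} - T. \<forall>t\<in>T. s < t"
    using ex_upper_subset_card[of "B - {0}" 5] card by auto
  have sum: "u + v \<notin> B" if "u \<in> T" "v \<in> T" "u \<noteq> v" for u v
    using sum_of_upper_divisors[OF L x T[unfolded B_def] card[unfolded B_def]] that
    unfolding B_def by (metis add.commute linorder_neqE_nat)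
  obtain vs where vs: "set vs = T" "distinct vs"
    using finite_distinct_list T(2) by (metis card.infinite zero_neq_numeral)
  then have "length vs = 5" using T(2) distinct_card by fastforce
  then obtain v1 v2 v3 v4 v5 where v: "vs = [v1, v2, v3, v4, v5]"
    by (auto simp: numeral_eq_Suc length_Suc_conv)
  show ?thesis
    unfolding B_def[symmetric]
  proof (rule not_planar_if_contains_complete_5)
    show "distinct [v1, v2, v3, v4, v5]" using vs(2) v by simp
    have T_eq: "{v1, v2, v3, v4, v5} = T" using vs(1) v by simp
    show "{v1, v2, v3, v4, v5} \<subseteq> verts (ideal_graph L (L - B))"
      unfolding T_eq verts by (rule T(1))
    show "{u, v} \<in> edges (ideal_graph L (L - B))"
      if "u \<in> {v1, v2, v3, v4, v5}" "v \<in> {v1, v2, v3, v4, v5}" "u \<noteq> v" for u v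
      using that edges sum T(1) unfolding T_eq by blast
  qed
qed

theorem theorem2p9:
  fixes L I :: "nat set" and n :: nat
  assumes "numerical_semigroup L"
    and "embedding_dimension L = n" and "n \<ge> 2"
    and "irreducible_ideal L I"
    and "graph_order (ideal_graph L I) \<ge> 8
       \<or> (graph_order (ideal_graph L I) = 6 \<and>
            (graph_isomorphic (ideal_graph L I) H\<^sub>5 \<or> graph_isomorphic (ideal_graph L I) H\<^sub>6))
       \<or> (graph_order (ideal_graph L I) = 7 \<and>
            (graph_isomorphic (ideal_graph L I) K\<^sub>4 \<or> graph_isomorphic (ideal_graph L I) K\<^sub>5
             \<or> graph_isomorphic (ideal_graph L I) K\<^sub>6))"
  shows "\<not> planar (ideal_graph L I)"
proof -
  obtain x where x: "x \<in> L" "I = L - divisors_in L x"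
    using irreducible_ideal_eq_Diff_divisors_in assms(1,4) by blast
  note iso = not_planar_if_isomorphic_contains_complete_bipartite_3_3[of "ideal_graph L I"]
  have "\<not> planar (ideal_graph L I)" if "graph_order (ideal_graph L I) \<ge> 8"
    using divisors_graph_not_planar[OF assms(1) x(1)] that x(2) by blast
  \<comment> \<open>The first three numerals form one class, the last three the other:
    \<open>{2, 4, 5}\<close> against \<open>{1, 3, 6}\<close>. The same choice serves
    \<open>H\<^sub>6\<close>, which is \<open>H\<^sub>5\<close> with the edge \<open>{1, 6}\<close>
    added.\<close>
  moreover have "\<not> planar (ideal_graph L I)" if "graph_isomorphic (ideal_graph L I) H\<^sub>5"
    using that by (rule iso[of _ 2 4 5 1 3 6]; (elim insertE emptyE)?; simp add: H\<^sub>5_def doubleton_eq_iff)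
  moreover have "\<not> planar (ideal_graph L I)" if "graph_isomorphic (ideal_graph L I) H\<^sub>6"
    using that by (rule iso[of _ 2 4 5 1 3 6]; (elim insertE emptyE)?; simp add: H\<^sub>6_def doubleton_eq_iff)
  \<comment> \<open>In the graphs of order 7 the vertex \<open>3\<close>, adjacent to all others,
    completes a class with two further vertices.\<close>
  moreover have "\<not> planar (ideal_graph L I)" if "graph_isomorphic (ideal_graph L I) K\<^sub>4"
    using that by (rule iso[of _ 1 2 3 4 5 6]; (elim insertE emptyE)?; simp add: K\<^sub>4_def doubleton_eq_iff)
  moreover have "\<not> planar (ideal_graph L I)" if "graph_isomorphic (ideal_graph L I) K\<^sub>5"
    using that by (rule iso[of _ 1 3 4 5 6 7]; (elim insertE emptyE)?; simp add: K\<^sub>5_def doubleton_eq_iff)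
  moreover have "\<not> planar (ideal_graph L I)" if "graph_isomorphic (ideal_graph L I) K\<^sub>6"
    using that by (rule iso[of _ 1 2 3 4 5 6]; (elim insertE emptyE)?; simp add: K\<^sub>6_def doubleton_eq_iff)
  ultimately show ?thesis
    using assms(5) by blast
qed

end
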